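(* Let $f(x,\theta)\in\mathbb{R}^m$ be differentiable in $\theta\in\mathbb{R}^n$, let $\zeta:\mathbb{R}^n\to\mathbb{R}^n$ be a smooth invertible function (independent of $x,y$), and write $\theta=\zeta(\gamma)$. Let $D_{x,y}$ be an arbitrary distribution over $(x,y)$, and let $A\in\mathbb{R}^{m\times m}$ be an invertible matrix-valued function of $x$, $y$ and $\theta$ whose value is parameterization invariant (i.e. in the $\gamma$ parameterization its value at $\gamma$ is its value at $\theta=\zeta(\gamma)$). Let $$B_\theta=\mathrm{E}_{D_{x,y}}[J_f^\top AJ_f],\qquad B_\gamma=\mathrm{E}_{D_{x,y}}[J_{f\circ\zeta}^\top A\,J_{f\circ\zeta}]$$ be the curvature matrices in the $\theta$ and $\gamma$ parameterizations respectively. Then $$J_\zeta^\top B_\theta J_\zeta=B_\gamma .$$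
   Context: $J_f$ is the Jacobian of $f(x,\theta)$ with respect to $\theta$ at $\theta=\zeta(\gamma)$, $J_{f\circ\zeta}$ is the Jacobian of $\gamma\mapsto f(x,\zeta(\gamma))$ with respect to $\gamma$, and $J_\zeta$ is the Jacobian of $\zeta$ at $\gamma$. The expectations are assumed to exist. *)

theory Defs
  imports "HOL-Probability.Probability"
begin

text \<open>
  \<open>C_times k g\<close>: the function \<open>g\<close> is \<open>k\<close> times continuously differentiable on the whole space.
  In the step, all directional derivatives of \<open>g\<close> are required to be \<open>k\<close> times continuously
  differentiable, which on a finite-dimensional space says the same about the derivative itself.
\<close>

primrec C_times :: "nat \<Rightarrow> ('a::euclidean_space \<Rightarrow> 'b::real_normed_vector) \<Rightarrow> bool" where
  "C_times 0 g \<longleftrightarrow> continuous_on UNIV g"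
| "C_times (Suc k) g \<longleftrightarrow>
     (\<forall>a. g differentiable (at a)) \<and> (\<forall>v. C_times k (\<lambda>a. frechet_derivative g (at a) v))"

definition smooth :: "('a::euclidean_space \<Rightarrow> 'b::real_normed_vector) \<Rightarrow> bool" where
  "smooth g \<longleftrightarrow> (\<forall>k. C_times k g)"

definition curvature_integrand ::
  "('x \<Rightarrow> real ^ 'n \<Rightarrow> real ^ 'm) \<Rightarrow> ('x \<Rightarrow> 'y \<Rightarrow> real ^ 'n \<Rightarrow> real ^ 'm ^ 'm) \<Rightarrow>
   real ^ 'n \<Rightarrow> 'x \<times> 'y \<Rightarrow> real ^ 'n ^ 'n" where
  "curvature_integrand f A w = (\<lambda>(x, y).
     transpose (jacobian (f x) (at w)) ** A x y w ** jacobian (f x) (at w))"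

text \<open>
  The curvature matrix at the parameter value \<open>w\<close>. The Bochner integral is \<open>0\<close> when the integrand
  is not integrable, so integrability has to be assumed wherever it is used.
\<close>

definition curvature_matrix ::
  "('x \<times> 'y) measure \<Rightarrow> ('x \<Rightarrow> real ^ 'n \<Rightarrow> real ^ 'm) \<Rightarrow>
   ('x \<Rightarrow> 'y \<Rightarrow> real ^ 'n \<Rightarrow> real ^ 'm ^ 'm) \<Rightarrow> real ^ 'n \<Rightarrow> real ^ 'n ^ 'n" where
  "curvature_matrix D f A w = integral\<^sup>L D (curvature_integrand f A w)"

end

theory Submission
  imports Defs
begin

text \<open>For each sample, the chain rule gives J_{f o \<zeta>} = J_f J_\<zeta>, so the integrand
  in the \<gamma> parameterization is J_\<zeta>^T M J_\<zeta>, where M is the integrand at \<theta>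
  (\<open>curvature_integrand_reparam\<close>). Since \<zeta> is independent of x and y, M |->
  J_\<zeta>^T M J_\<zeta> is one fixed linear map (\<open>bounded_linear_matrix_sandwich\<close>),
  and expectation commutes with it.\<close>

lemma smooth_imp_differentiable:
  assumes "smooth g"
  shows "g differentiable (at a)"
proof -
  have "C_times (Suc 0) g"
    using assms unfolding smooth_def by blast
  then show ?thesis
    by simp
qed

text \<open>The chain rule composes the derivatives as linear maps; taking matrices turns
  composition into a product.\<close>

lemma jacobian_compose:
  fixes g :: "real ^ 'k \<Rightarrow> real ^ 'n" and f :: "real ^ 'n \<Rightarrow> real ^ 'm"
  assumes g: "g differentiable (at a)" and f: "f differentiable (at (g a))"
  shows "jacobian (\<lambda>z. f (g z)) (at a) = jacobian f (at (g a)) ** jacobian g (at a)"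
proof -
  have "frechet_derivative (f \<circ> g) (at a)
      = frechet_derivative f (at (g a)) \<circ> frechet_derivative g (at a)"
    using g f by (rule frechet_derivative_compose)
  moreover have "linear (frechet_derivative f (at (g a)))" "linear (frechet_derivative g (at a))"
    using g f by (simp_all add: linear_frechet_derivative)
  ultimately show ?thesis
    by (simp add: jacobian_def matrix_compose o_def[of f g])
qed

text \<open>Linearity suffices, since the matrix space is finite-dimensional. Boundedness is what
  allows P and Q to be pulled out of a Bochner integral.\<close>

lemma bounded_linear_matrix_sandwich:
  fixes P :: "real ^ 'n ^ 'k" and Q :: "real ^ 'l ^ 'm"
  shows "bounded_linear (\<lambda>M. P ** M ** Q)"
proof -
  have "linear (\<lambda>M. P ** M ** Q)"
    \<comment> \<open>The entrywise \<open>simp\<close> supplies distributivity over a sum in the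
      left factor.\<close>
    by (rule linearI)
      (simp_all add: matrix_add_ldistrib matrix_scalar_ac scalar_matrix_assoc,
       simp add: vec_eq_iff matrix_matrix_mult_def distrib_right sum.distrib)
  then show ?thesis
    by (simp add: linear_conv_bounded_linear)
qed

text \<open>Transposition reverses the product J_f J_\<zeta>, so the factors J_\<zeta>^T and
  J_\<zeta> end up on the outside, while invariance leaves the middle factor A unchanged.\<close>

lemma curvature_integrand_reparam:
  fixes f :: "'x \<Rightarrow> real ^ 'n \<Rightarrow> real ^ 'm" and \<zeta> :: "real ^ 'n \<Rightarrow> real ^ 'n"
  assumes f: "\<And>x. f x differentiable (at (\<zeta> g))" and \<zeta>: "\<zeta> differentiable (at g)"
    and A': "\<And>x y. A' x y g = A x y (\<zeta> g)"
  shows "curvature_integrand (\<lambda>x g. f x (\<zeta> g)) A' g p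
       = transpose (jacobian \<zeta> (at g)) ** curvature_integrand f A (\<zeta> g) p ** jacobian \<zeta> (at g)"
  using jacobian_compose[OF \<zeta> f] A'
  by (cases p) (simp add: curvature_integrand_def matrix_transpose_mul matrix_mul_assoc)

theorem mainTheorem7:
  fixes D :: "('x \<times> 'y) measure"
    and f :: "'x \<Rightarrow> real ^ 'n \<Rightarrow> real ^ 'm"
    and A :: "'x \<Rightarrow> 'y \<Rightarrow> real ^ 'n \<Rightarrow> real ^ 'm ^ 'm"
    and A\<^sub>\<gamma> :: "'x \<Rightarrow> 'y \<Rightarrow> real ^ 'n \<Rightarrow> real ^ 'm ^ 'm"
    and \<zeta> :: "real ^ 'n \<Rightarrow> real ^ 'n"
    and \<gamma> \<theta> :: "real ^ 'n"
  assumes D: "prob_space D"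
    and f: "\<And>x t. f x differentiable (at t)"
    and \<zeta>: "smooth \<zeta>" "bij \<zeta>"
    and A: "\<And>x y t. invertible (A x y t)"
    and A_invariant: "\<And>x y g. A\<^sub>\<gamma> x y g = A x y (\<zeta> g)"
    and \<theta>: "\<theta> = \<zeta> \<gamma>"
    and exists_\<theta>: "integrable D (curvature_integrand f A \<theta>)"
    and exists_\<gamma>: "integrable D (curvature_integrand (\<lambda>x g. f x (\<zeta> g)) A\<^sub>\<gamma> \<gamma>)"
  shows "transpose (jacobian \<zeta> (at \<gamma>)) ** curvature_matrix D f A \<theta> ** jacobian \<zeta> (at \<gamma>)
       = curvature_matrix D (\<lambda>x g. f x (\<zeta> g)) A\<^sub>\<gamma> \<gamma>"
proof -
  have "curvature_matrix D (\<lambda>x g. f x (\<zeta> g)) A\<^sub>\<gamma> \<gamma>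
      = (\<integral>p. transpose (jacobian \<zeta> (at \<gamma>)) ** curvature_integrand f A \<theta> p ** jacobian \<zeta> (at \<gamma>) \<partial>D)"
    unfolding curvature_matrix_def \<theta>
    using f smooth_imp_differentiable[OF \<zeta>(1)] A_invariant
    by (intro Bochner_Integration.integral_cong refl curvature_integrand_reparam)
  also have "\<dots> = transpose (jacobian \<zeta> (at \<gamma>)) ** curvature_matrix D f A \<theta> ** jacobian \<zeta> (at \<gamma>)"
    unfolding curvature_matrix_def
    \<comment> \<open>J_\<zeta> is constant over the samples; integrability at \<theta> justifies
      moving it out of the expectation.\<close>
    by (rule integral_bounded_linear[OF bounded_linear_matrix_sandwich exists_\<theta>])
  finally show ?thesis ..
qed

end
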